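(* Assume that the sequence of entropies $(\mathcal{H}(\eta|\pi_{2l}))_{l\ge0}$ or the sequence $(\mathcal{H}(\mu|\pi_{2l+1}))_{l\ge 0}$ is summable. Then the following are equivalent: (i) $\lim_{n\to\infty}\mathcal{H}(P_{\mu,\eta}|\mathcal{P}_{2n})=0$; (ii) for every $n\ge0$, $\displaystyle\mathcal{H}(P_{\mu,\eta}|\mathcal{P}_{2n})=\sum_{l\ge n}\left[\mathcal{H}(\eta|\pi_{2l})+\mathcal{H}(\mu|\pi_{2l+1})\right]$.
   Context: $\mu,\eta$ are probability measures on measurable spaces $\mathbb{X},\mathbb{Y}$, and $K$ is a Markov transition from $\mathbb{X}$ to $\mathbb{Y}$. $\Pi(\mu,\eta)$ is the set of probability measures on $\mathbb{X}\times\mathbb{Y}$ with marginals $\mu$ and $\eta$. $\mathcal{H}(Q|P)=\int\log\frac{dQ}{dP}dQ$ is the relative entropy ($+\infty$ if $Q\not\ll P$). With reference measure $P:=\mu(dx)K(x,dy)$, the Schrödinger bridge is $P_{\mu,\eta}:=\mathrm{argmin}_{Q\in\Pi(\mu,\eta)}\mathcal{H}(Q|P)$; it is well defined under the standing assumption that $\mathcal{H}(Q|P)<\infty$ for some $Q\in\Pi(\mu,\eta)$. Sinkhorn iterations: $\mathcal{K}_0:=K$ and, for $n\ge0$, $\pi_{2n}:=\mu\mathcal{K}_{2n}$, $\pi_{2n+1}:=\eta\mathcal{K}_{2n+1}$ (with $(\mu L)(dy)=\int\mu(dx)L(x,dy)$), where $\mathcal{K}_{2n+1}$ (from $\mathbb{Y}$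 to $\mathbb{X}$) and $\mathcal{K}_{2(n+1)}$ (from $\mathbb{X}$ to $\mathbb{Y}$) are Markov transitions defined by the Bayes formulae $$\mu(dx)\mathcal{K}_{2n}(x,dy)=\pi_{2n}(dy)\mathcal{K}_{2n+1}(y,dx),\qquad \eta(dy)\mathcal{K}_{2n+1}(y,dx)=\pi_{2n+1}(dx)\mathcal{K}_{2(n+1)}(x,dy)$$ (assumed to exist). The Sinkhorn bridges are $\mathcal{P}_{2n}(d(x,y))=\mu(dx)\mathcal{K}_{2n}(x,dy)$ and $\mathcal{P}_{2n+1}(d(x,y))=\eta(dy)\mathcal{K}_{2n+1}(y,dx)$; in particular $\mathcal{P}_0=P$. *)

theory Defs
  imports "HOL-Probability.Probability"
begin

(* KL_divergence b P Q is the Bochner integral of log_b (dQ/dP) with respect to Q.  For probability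
   measures the negative part of log (dQ/dP) is always Q-integrable, so if Q << P and the integrand is
   not Bochner integrable, then its integral is +infinity. *)
definition relative_entropy :: "'a measure \<Rightarrow> 'a measure \<Rightarrow> ereal" where
  "relative_entropy Q P =
     (if absolutely_continuous P Q \<and> integrable Q (entropy_density (exp 1) P Q)
      then ereal (KL_divergence (exp 1) P Q) else \<infinity>)"

(* The underlying measurable spaces are those carried by the measures themselves. *)
definition couplings :: "'a measure \<Rightarrow> 'b measure \<Rightarrow> ('a \<times> 'b) measure set" where
  "couplings \<mu> \<eta> =
     {Q. prob_space Q \<and> sets Q = sets (\<mu> \<Otimes>\<^sub>M \<eta>) \<and> distr Q \<mu> fst = \<mu> \<and> distr Q \<eta> snd = \<eta>}"

(* A Markov transition from M to N is an element of M \<rightarrow>\<^sub>M prob_algebra N; the measure M L of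
   the text is the Giry bind of M and L. *)

(* The measure M(dx) L(x,dy); only the sigma-algebra of N is used. *)
definition joint :: "'a measure \<Rightarrow> 'b measure \<Rightarrow> ('a \<Rightarrow> 'b measure) \<Rightarrow> ('a \<times> 'b) measure" where
  "joint M N L = M \<bind> (\<lambda>x. distr (L x) (M \<Otimes>\<^sub>M N) (Pair x))"

(* The measure N(dy) L(y,dx), regarded as a measure in (x,y); only the sigma-algebra of M is used. *)
definition joint_rev :: "'a measure \<Rightarrow> 'b measure \<Rightarrow> ('b \<Rightarrow> 'a measure) \<Rightarrow> ('a \<times> 'b) measure" where
  "joint_rev M N L = N \<bind> (\<lambda>y. distr (L y) (M \<Otimes>\<^sub>M N) (\<lambda>x. (x, y)))"

definition schrodinger_bridge ::
    "'a measure \<Rightarrow> 'b measure \<Rightarrow> ('a \<Rightarrow> 'b measure) \<Rightarrow> ('a \<times> 'b) measure" where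
  "schrodinger_bridge \<mu> \<eta> K = arg_min_on (\<lambda>Q. relative_entropy Q (joint \<mu> \<eta> K)) (couplings \<mu> \<eta>)"

(* Since the transitions alternate between the two directions, they form two sequences:
   A n is the transition with index 2n, B n the one with index 2n+1.  The Bayes formulae determine
   them only almost everywhere, whence a predicate instead of a function. *)
definition sinkhorn_transitions ::
    "'a measure \<Rightarrow> 'b measure \<Rightarrow> ('a \<Rightarrow> 'b measure) \<Rightarrow>
     (nat \<Rightarrow> 'a \<Rightarrow> 'b measure) \<Rightarrow> (nat \<Rightarrow> 'b \<Rightarrow> 'a measure) \<Rightarrow> bool" where
  "sinkhorn_transitions \<mu> \<eta> K A B \<longleftrightarrow>
     A 0 = K \<and>
     (\<forall>n. A n \<in> \<mu> \<rightarrow>\<^sub>M prob_algebra \<eta>) \<and>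
     (\<forall>n. B n \<in> \<eta> \<rightarrow>\<^sub>M prob_algebra \<mu>) \<and>
     (\<forall>n. joint \<mu> \<eta> (A n) = joint_rev \<mu> (\<mu> \<bind> A n) (B n)) \<and>
     (\<forall>n. joint_rev \<mu> \<eta> (B n) = joint (\<eta> \<bind> B n) \<eta> (A (Suc n)))"

end

theory Submission
  imports Defs
begin

text \<open>If \<open>Q\<close> is a coupling of \<open>\<mu>\<close> and \<open>\<eta>\<close> with finite entropy relative to \<open>P\<^sub>0\<close>, the chain rule for the relative
  entropy along the two coordinate projections turns each Bayes formula into an identity between finite
  quantities,
  \<open>H(Q|P\<^sub>2\<^sub>n) = H(\<eta>|\<pi>\<^sub>2\<^sub>n) + H(\<mu>|\<pi>\<^sub>2\<^sub>n\<^sub>+\<^sub>1) + H(Q|P\<^sub>2\<^sub>n\<^sub>+\<^sub>2)\<close>.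
  The nonnegative sequence \<open>H(Q|P\<^sub>2\<^sub>n)\<close> thus telescopes, and it equals the sum of its decrements if and only if
  it tends to \<open>0\<close>.  As the Schroedinger bridge is a choice among minimizers, one must also know that a
  minimizer exists, since otherwise it would be an arbitrary measure.\<close>

subsection \<open>Relative entropy and its chain rule\<close>

text \<open>The Radon-Nikodym derivative is determined only almost everywhere, so any chosen density
  \<open>f\<close> may replace \<open>RN_deriv\<close> inside the entropy density. This lets the
  later arguments work with real densities that are nonnegative at every point.\<close>

lemma relative_entropy_density:
  assumes "prob_space P" and f[measurable]: "f \<in> borel_measurable P" and nonneg: "\<And>x. 0 \<le> f x"
  shows "relative_entropy (density P f) P =
    (if integrable (density P f) (\<lambda>x. ln (f x)) then ereal (\<integral>x. ln (f x) \<partial>density P f) else \<infinity>)"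
proof -
  interpret P: prob_space P by fact
  have "density P (RN_deriv P (density P f)) = density P f"
    by (intro density_RN_deriv_density) simp
  then have "AE x in P. RN_deriv P (density P f) x = ennreal (f x)"
    by (intro P.density_unique) auto
  then have eq: "AE x in density P f. entropy_density (exp 1) P (density P f) x = ln (f x)"
    by (subst AE_density) (use nonneg in \<open>auto simp: entropy_density_def log_ln\<close>)
  have meas: "entropy_density (exp 1) P (density P f) \<in> borel_measurable (density P f)"
    by (simp add: entropy_density_def comp_def)
  have "absolutely_continuous P (density P f)"
    by (rule absolutely_continuousI_density) simp
  moreover have "integrable (density P f) (entropy_density (exp 1) P (density P f)) \<longleftrightarrow>
      integrable (density P f) (\<lambda>x. ln (f x))"
    by (rule integrable_cong_AE[OF meas _ eq]) simp
  moreover have "KL_divergence (exp 1) P (density P f) = (\<integral>x. ln (f x) \<partial>density P f)"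
    unfolding KL_divergence_def by (rule integral_cong_AE[OF meas _ eq]) simp
  ultimately show ?thesis
    by (simp add: relative_entropy_def)
qed

lemma absolutely_continuous_real_density:
  assumes "prob_space P" "prob_space Q" "sets Q = sets P" "absolutely_continuous P Q"
  obtains f :: "'a \<Rightarrow> real"
    where "f \<in> borel_measurable P" "\<And>x. 0 \<le> f x" "Q = density P f"
proof -
  interpret P: prob_space P by fact
  interpret Q: prob_space Q by fact
  obtain f where f: "f \<in> borel_measurable P" "AE x in P. RN_deriv P Q x = ennreal (f x)"
    "AE x in Q. 0 < f x" "\<And>x. 0 \<le> f x"
    using P.real_RN_deriv[OF Q.finite_measure_axioms assms(4,3)] by blast
  have "Q = density P (RN_deriv P Q)"
    by (rule P.density_RN_deriv[OF assms(4,3), symmetric])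
  also have "\<dots> = density P f"
    using f by (intro density_cong) auto
  finally show thesis
    using f that by blast
qed

lemma relative_entropy_finiteE:
  assumes "prob_space P" "prob_space Q" "sets Q = sets P" "relative_entropy Q P < \<infinity>"
  obtains f :: "'a \<Rightarrow> real"
    where "f \<in> borel_measurable P" "\<And>x. 0 \<le> f x" "Q = density P f"
      "integrable Q (\<lambda>x. ln (f x))" "relative_entropy Q P = ereal (\<integral>x. ln (f x) \<partial>Q)"
proof -
  have "absolutely_continuous P Q"
    using assms(4) by (auto simp: relative_entropy_def split: if_splits)
  then obtain f :: "'a \<Rightarrow> real"
    where f: "f \<in> borel_measurable P" "\<And>x. 0 \<le> f x" "Q = density P f"
    using absolutely_continuous_real_density assms(1-3) by blast
  show thesis
    using relative_entropy_density[OF assms(1) f(1,2)] assms(4) f that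
    by (auto split: if_splits)
qed

text \<open>This is the tangent line of the convex function t ln t at 1, that is, ln (1/x) \<le> 1/x
  - 1 multiplied by x. The value 0 * ln 0 = 0 is the continuous extension at 0.\<close>

lemma mult_ln_ge: "x - 1 \<le> x * ln x" if "0 \<le> x" for x :: real
proof (cases "x = 0")
  case False
  with that have "ln (1 / x) \<le> 1 / x - 1"
    by (intro ln_le_minus_one) auto
  then have "x * (1 - 1 / x) \<le> x * ln x"
    using that False by (intro mult_left_mono) (auto simp: ln_div)
  then show ?thesis
    using False by (simp add: right_diff_distrib)
qed simp

text \<open>Integrating against \<open>density P f\<close> puts the weight f in front of the
  logarithm, and t * max 0 (- ln t) \<le> 1 because t ln t \<ge> t - 1. Hence only the positive part
  of ln f can make the entropy infinite.\<close>

lemma integrable_neg_ln_density: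
  fixes f :: "'a \<Rightarrow> real"
  assumes "prob_space P" and [measurable]: "f \<in> borel_measurable P" and nonneg: "\<And>x. 0 \<le> f x"
  shows "integrable (density P f) (\<lambda>x. max 0 (- ln (f x)))"
proof -
  interpret P: prob_space P by fact
  have "f x * max 0 (- ln (f x)) \<le> 1" for x
    using mult_ln_ge[OF nonneg[of x]] nonneg[of x]
    by (cases "ln (f x) \<le> 0") (auto simp: max_def)
  then have "integrable P (\<lambda>x. f x * max 0 (- ln (f x)))"
    by (intro P.integrable_const_bound[where B = 1]) (auto simp: nonneg)
  then show ?thesis
    by (subst integrable_real_density) (auto simp: nonneg)
qed

lemma integrable_prob_density:
  fixes f :: "'a \<Rightarrow> real"
  assumes "prob_space (density P f)" and [measurable]: "f \<in> borel_measurable P"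
    and nonneg: "\<And>x. 0 \<le> f x"
  shows "integrable P f" "(\<integral>x. f x \<partial>P) = 1"
proof -
  interpret prob_space "density P f" by fact
  have "(\<integral>\<^sup>+x. ennreal (f x) \<partial>P) = 1"
    using emeasure_space_1 by (simp add: emeasure_density cong: nn_integral_cong)
  then show "integrable P f" "(\<integral>x. f x \<partial>P) = 1"
    by (auto intro!: integrableI_nonneg simp: nonneg integral_eq_nn_integral)
qed

text \<open>Gibbs' inequality: the tangent bound f - 1 \<le> f ln f is integrated against
  \<open>P\<close>, and its left side integrates to 0 since f has mass 1.\<close>

lemma relative_entropy_nonneg:
  assumes "prob_space P" "prob_space Q" "sets Q = sets P"
  shows "0 \<le> relative_entropy Q P"
proof (cases "relative_entropy Q P < \<infinity>")
  case True
  then obtain f :: "'a \<Rightarrow> real" where [measurable]: "f \<in> borel_measurable P"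
    and nonneg: "\<And>x. 0 \<le> f x" and Q: "Q = density P f"
    and int: "integrable Q (\<lambda>x. ln (f x))" and H: "relative_entropy Q P = ereal (\<integral>x. ln (f x) \<partial>Q)"
    using relative_entropy_finiteE[OF assms] by blast
  interpret P: prob_space P by fact
  note f = integrable_prob_density[of P f] Q \<open>prob_space Q\<close>
  have "integrable P (\<lambda>x. f x * ln (f x))"
    using int unfolding Q by (subst (asm) integrable_real_density) (auto simp: nonneg)
  then have "(\<integral>x. f x - 1 \<partial>P) \<le> (\<integral>x. f x * ln (f x) \<partial>P)"
    using f nonneg by (intro integral_mono mult_ln_ge) auto
  also have "\<dots> = (\<integral>x. ln (f x) \<partial>Q)"
    unfolding Q by (subst integral_real_density) (auto simp: nonneg)
  finally show ?thesis
    unfolding H using f nonneg by (simp add: P.prob_space)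
qed auto

text \<open>The identity is \<open>ln f = ln (g \<circ> T) + ln h\<close> with \<open>f = dQ/dP\<close> and \<open>h = f / (g \<circ> T)\<close>.  Both summands
  have an integrable negative part, so both are integrable as soon as their sum is.\<close>

lemma relative_entropy_chain:
  assumes "prob_space P" "prob_space Q" and sets: "sets Q = sets P"
    and T[measurable]: "T \<in> P \<rightarrow>\<^sub>M N" and fin: "relative_entropy Q P < \<infinity>"
  obtains g :: "'b \<Rightarrow> real" where "g \<in> borel_measurable N" "\<And>y. 0 \<le> g y"
    "distr Q N T = density (distr P N T) g"
    "relative_entropy Q P =
       relative_entropy (distr Q N T) (distr P N T) + relative_entropy Q (density P (\<lambda>x. g (T x)))"
    "relative_entropy (distr Q N T) (distr P N T) < \<infinity>"
    "relative_entropy Q (density P (\<lambda>x. g (T x))) < \<infinity>"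
proof -
  interpret P: prob_space P by fact
  interpret Q: prob_space Q by fact
  have TQ[measurable]: "T \<in> Q \<rightarrow>\<^sub>M N"
    using T sets by (simp cong: measurable_cong_sets)
  obtain f :: "'a \<Rightarrow> real" where f[measurable]: "f \<in> borel_measurable P"
    and f0: "\<And>x. 0 \<le> f x" and Q: "Q = density P f"
    and int: "integrable Q (\<lambda>x. ln (f x))" and H: "relative_entropy Q P = ereal (\<integral>x. ln (f x) \<partial>Q)"
    using relative_entropy_finiteE[OF assms(1-3) fin] by blast
  let ?\<pi> = "distr P N T" and ?\<eta> = "distr Q N T"
  have \<pi>: "prob_space ?\<pi>" and \<eta>: "prob_space ?\<eta>"
    by (simp_all add: P.prob_space_distr Q.prob_space_distr)
  have "absolutely_continuous P Q"
    unfolding Q by (rule absolutely_continuousI_density) simp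
  then have "absolutely_continuous ?\<pi> ?\<eta>"
    using sets_eq_imp_space_eq[OF sets]
    by (auto simp: absolutely_continuous_def null_sets_def emeasure_distr sets subset_eq)
  then obtain g :: "'b \<Rightarrow> real" where "g \<in> borel_measurable ?\<pi>"
    and g0: "\<And>y. 0 \<le> g y" and \<eta>_eq: "?\<eta> = density ?\<pi> g"
    using absolutely_continuous_real_density[OF \<pi> \<eta>] by auto
  then have g[measurable]: "g \<in> borel_measurable N" by simp
  \<comment> \<open>\<open>P'\<close> is \<open>P\<close> with its image under \<open>T\<close>
    replaced by that of \<open>Q\<close>, while the conditional laws given \<open>T\<close> are
    kept.\<close>
  define P' where "P' = density P (\<lambda>x. g (T x))"
  have "emeasure P' (space P') = emeasure ?\<eta> (space ?\<eta>)"
    unfolding \<eta>_eq P'_def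
    by (simp add: emeasure_density nn_integral_distr measurable_space[OF T] cong: nn_integral_cong)
  then have "prob_space P'"
    by (intro prob_spaceI) (use prob_space.emeasure_space_1[OF \<eta>] in simp)
  \<comment> \<open>The quotient of f by g o T is harmless where the denominator vanishes: this set
    is null for \<open>Q\<close>, so f vanishes on it almost everywhere with respect to
    \<open>P\<close>.\<close>
  have "AE y in ?\<eta>. g y \<noteq> 0"
    unfolding \<eta>_eq by (subst AE_density) auto
  then have "AE x in Q. g (T x) \<noteq> 0"
    by (subst (asm) AE_distr_iff) auto
  then have AE_g: "AE x in P. 0 < f x \<longrightarrow> g (T x) \<noteq> 0"
    unfolding Q by (subst (asm) AE_density) auto
  define h where "h x = f x / g (T x)" for x
  have h[measurable]: "h \<in> borel_measurable P"
    unfolding h_def[abs_def] by measurable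
  have h0: "0 \<le> h x" for x
    by (simp add: h_def f0 g0)
  have Q': "Q = density P' h"
    unfolding Q P'_def
  proof (subst density_density_eq)
    show "density P (\<lambda>x. ennreal (f x)) = density P (\<lambda>x. ennreal (g (T x)) * ennreal (h x))"
      using AE_g f0 g0 h0
      by (intro density_cong) (auto simp: h_def ennreal_mult[symmetric] less_le elim!: eventually_mono)
  qed auto
  have int_g_iff: "integrable ?\<eta> (\<lambda>y. ln (g y)) \<longleftrightarrow> integrable Q (\<lambda>x. ln (g (T x)))"
    by (subst integrable_distr_eq) auto
  have neg_g: "integrable Q (\<lambda>x. max 0 (- ln (g (T x))))"
  proof -
    have "integrable ?\<eta> (\<lambda>y. max 0 (- ln (g y)))"
      unfolding \<eta>_eq by (rule integrable_neg_ln_density[OF \<pi>]) (auto simp: g0)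
    then show ?thesis
      by (subst (asm) integrable_distr_eq) auto
  qed
  have neg_h: "integrable Q (\<lambda>x. max 0 (- ln (h x)))"
    unfolding Q' by (rule integrable_neg_ln_density[OF \<open>prob_space P'\<close>]) (auto simp: h0 P'_def)
  have "AE x in Q. 0 < f x"
    unfolding Q by (subst AE_density) auto
  then have AE_ln: "AE x in Q. ln (f x) = ln (g (T x)) + ln (h x)"
    using \<open>AE x in Q. g (T x) \<noteq> 0\<close>
  proof eventually_elim
    case (elim x)
    then show ?case using g0[of "T x"] by (simp add: h_def ln_div)
  qed
  \<comment> \<open>If s = u + v, then |u| \<le> |s| + max 0 (-u) + max 0 (-v): either u is
    negative, or u = s - v. Here s = ln f is integrable because the entropy is finite, and both
    negative parts are integrable because \<open>g\<close> and \<open>h\<close> are probability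
    densities.\<close>
  have int_g: "integrable Q (\<lambda>x. ln (g (T x)))"
  proof (rule Bochner_Integration.integrable_bound)
    show "integrable Q (\<lambda>x. \<bar>ln (f x)\<bar> + max 0 (- ln (g (T x))) + max 0 (- ln (h x)))"
      using int neg_g neg_h by auto
    show "AE x in Q. norm (ln (g (T x)))
        \<le> norm (\<bar>ln (f x)\<bar> + max 0 (- ln (g (T x))) + max 0 (- ln (h x)))"
      using AE_ln by eventually_elim auto
  qed (simp add: sets cong: measurable_cong_sets)
  have int_h: "integrable Q (\<lambda>x. ln (h x))"
    using Bochner_Integration.integrable_diff[OF int int_g] AE_ln
    by (subst integrable_cong_AE[where g = "\<lambda>x. ln (f x) - ln (g (T x))"])
      (auto simp: sets cong: measurable_cong_sets elim!: eventually_mono)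
  have H_g: "relative_entropy ?\<eta> ?\<pi> = ereal (\<integral>x. ln (g (T x)) \<partial>Q)"
  proof -
    have "(\<integral>y. ln (g y) \<partial>?\<eta>) = (\<integral>x. ln (g (T x)) \<partial>Q)"
      by (rule integral_distr) auto
    then show ?thesis
      using relative_entropy_density[OF \<pi>, of g] int_g int_g_iff g0 by (simp add: \<eta>_eq)
  qed
  have H_h: "relative_entropy Q P' = ereal (\<integral>x. ln (h x) \<partial>Q)"
    using relative_entropy_density[OF \<open>prob_space P'\<close>, of h] int_h h0
    by (simp add: Q'[symmetric]) (simp add: P'_def)
  have "(\<integral>x. ln (f x) \<partial>Q) = (\<integral>x. ln (g (T x)) + ln (h x) \<partial>Q)"
    using AE_ln by (intro integral_cong_AE) (auto simp: sets cong: measurable_cong_sets)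
  then have "relative_entropy Q P = relative_entropy ?\<eta> ?\<pi> + relative_entropy Q P'"
    using int_g int_h by (simp add: H H_g H_h)
  then show thesis
    using that[of g] g g0 \<eta>_eq H_g H_h by (simp add: P'_def)
qed

subsection \<open>Joint measures of a Markov transition\<close>

text \<open>The map \<open>c\<close> stands for either order of the pair, so that one proof serves
  both \<open>joint\<close> and \<open>joint_rev\<close>. Since \<open>T\<close> recovers the
  starting point, g o T has the constant value \<open>g x\<close> along \<open>c x\<close>, and the
  density passes through the bind.\<close>

lemma density_bind_distr:
  fixes g :: "'a \<Rightarrow> real"
  assumes "prob_space M" and L[measurable]: "L \<in> M \<rightarrow>\<^sub>M prob_algebra N"
    and c[measurable]: "case_prod c \<in> M \<Otimes>\<^sub>M N \<rightarrow>\<^sub>M R" and T[measurable]: "T \<in> R \<rightarrow>\<^sub>M M"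
    and Tc: "\<And>x y. x \<in> space M \<Longrightarrow> y \<in> space N \<Longrightarrow> T (c x y) = x"
    and g[measurable]: "g \<in> borel_measurable M" and "prob_space (density M g)"
  shows "density M g \<bind> (\<lambda>x. distr (L x) R (c x)) = density (M \<bind> (\<lambda>x. distr (L x) R (c x))) (\<lambda>z. g (T z))"
proof -
  interpret prob_space M by fact
  define k where "k x = distr (L x) R (c x)" for x
  have k[measurable]: "k \<in> M \<rightarrow>\<^sub>M prob_algebra R"
    unfolding k_def by measurable
  then have k'[measurable]: "k \<in> density M g \<rightarrow>\<^sub>M prob_algebra R"
    by (simp cong: measurable_cong_sets)
  have M: "M \<in> space (prob_algebra M)" and Mg: "density M g \<in> space (prob_algebra (density M g))"
    using assms by (auto simp: space_prob_algebra)
  have sets[measurable_cong]: "sets (M \<bind> k) = sets R"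
    by (rule sets_bind'[OF M k])
  have "density M g \<bind> k = density (M \<bind> k) (\<lambda>z. g (T z))"
  proof (rule measure_eqI)
    show "sets (density M g \<bind> k) = sets (density (M \<bind> k) (\<lambda>z. g (T z)))"
      using sets_bind'[OF Mg k'] by (simp add: sets)
  next
    fix E assume "E \<in> sets (density M g \<bind> k)"
    then have E[measurable]: "E \<in> sets R"
      using sets_bind'[OF Mg k'] by simp
    have [measurable]: "(\<lambda>x. emeasure (k x) E) \<in> borel_measurable M"
      using measurable_compose[OF measurable_prob_algebraD[OF k] measurable_emeasure_subprob_algebra[OF E]] .
    have "emeasure (density M g \<bind> k) E = (\<integral>\<^sup>+x. ennreal (g x) * emeasure (k x) E \<partial>M)"
      by (subst emeasure_bind_prob_algebra[OF Mg k' E]) (subst nn_integral_density; measurable)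
    also have "\<dots> = (\<integral>\<^sup>+x. \<integral>\<^sup>+z. ennreal (g (T z)) * indicator E z \<partial>k x \<partial>M)"
    proof (rule nn_integral_cong)
      fix x assume x: "x \<in> space M"
      have Lx: "L x \<in> space (prob_algebra N)"
        using L x by (rule measurable_space)
      then have [measurable_cong, simp]: "sets (L x) = sets N"
        by (simp add: space_prob_algebra)
      have [simp]: "space (L x) = space N"
        by (rule sets_eq_imp_space_eq) simp
      have [measurable]: "c x \<in> N \<rightarrow>\<^sub>M R"
        using measurable_compose[OF measurable_Pair1'[OF x] c] by simp
      have "(\<integral>\<^sup>+z. ennreal (g (T z)) * indicator E z \<partial>k x) =
          (\<integral>\<^sup>+y. ennreal (g x) * indicator E (c x y) \<partial>L x)"
        unfolding k_def by (subst nn_integral_distr) (auto intro!: nn_integral_cong simp: Tc x)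
      also have "\<dots> = ennreal (g x) * (\<integral>\<^sup>+y. indicator E (c x y) \<partial>L x)"
        by (rule nn_integral_cmult) simp
      also have "(\<integral>\<^sup>+y. indicator E (c x y) \<partial>L x) = (\<integral>\<^sup>+z. indicator E z \<partial>k x)"
        unfolding k_def by (subst nn_integral_distr) auto
      also have "\<dots> = emeasure (k x) E"
        by (simp add: k_def)
      finally show "ennreal (g x) * emeasure (k x) E =
          (\<integral>\<^sup>+z. ennreal (g (T z)) * indicator E z \<partial>k x)" ..
    qed
    also have "\<dots> = (\<integral>\<^sup>+z. ennreal (g (T z)) * indicator E z \<partial>(M \<bind> k))"
      by (rule nn_integral_bind[symmetric, OF _ measurable_prob_algebraD[OF k]]) measurable
    also have "\<dots> = emeasure (density (M \<bind> k) (\<lambda>z. g (T z))) E"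
      by (subst emeasure_density) (auto simp: sets)
    finally show "emeasure (density M g \<bind> k) E = emeasure (density (M \<bind> k) (\<lambda>z. g (T z))) E" .
  qed
  then show ?thesis
    by (simp add: k_def[abs_def])
qed

text \<open>\<open>S\<close> reads the arrival point off \<open>c x y\<close>, so it undoes each
  inner image measure and leaves \<open>L x\<close>.\<close>

lemma distr_bind_distr:
  assumes "prob_space M" and L[measurable]: "L \<in> M \<rightarrow>\<^sub>M prob_algebra N"
    and c[measurable]: "case_prod c \<in> M \<Otimes>\<^sub>M N \<rightarrow>\<^sub>M R" and S[measurable]: "S \<in> R \<rightarrow>\<^sub>M N"
    and Sc: "\<And>x y. x \<in> space M \<Longrightarrow> y \<in> space N \<Longrightarrow> S (c x y) = y"
  shows "distr (M \<bind> (\<lambda>x. distr (L x) R (c x))) N S = M \<bind> L"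
proof -
  interpret prob_space M by fact
  have k: "(\<lambda>x. distr (L x) R (c x)) \<in> M \<rightarrow>\<^sub>M subprob_algebra R"
    by (rule measurable_prob_algebraD) measurable
  have "distr (M \<bind> (\<lambda>x. distr (L x) R (c x))) N S = M \<bind> (\<lambda>x. distr (distr (L x) R (c x)) N S)"
    by (rule distr_bind[OF k not_empty S])
  also have "\<dots> = M \<bind> L"
  proof (rule bind_cong[OF refl])
    fix x assume x: "x \<in> space M"
    have "L x \<in> space (prob_algebra N)"
      using L x by (rule measurable_space)
    then have [measurable_cong, simp]: "sets (L x) = sets N"
      by (simp add: space_prob_algebra)
    have [simp]: "space (L x) = space N"
      by (rule sets_eq_imp_space_eq) simp
    have [measurable]: "c x \<in> N \<rightarrow>\<^sub>M R"
      using measurable_compose[OF measurable_Pair1'[OF x] c] by simp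
    have "distr (distr (L x) R (c x)) N S = distr (L x) N (S \<circ> c x)"
      by (rule distr_distr) auto
    also have "\<dots> = distr (L x) (L x) (\<lambda>y. y)"
      by (rule distr_cong) (auto simp: Sc x)
    finally show "distr (distr (L x) R (c x)) N S = L x"
      by simp
  qed
  finally show ?thesis .
qed

lemma
  assumes "prob_space M" and L[measurable]: "L \<in> M \<rightarrow>\<^sub>M prob_algebra N"
  shows prob_space_joint: "prob_space (joint M N L)"
    and sets_joint: "sets (joint M N L) = sets (M \<Otimes>\<^sub>M N)"
    and distr_joint_snd: "distr (joint M N L) N snd = M \<bind> L"
proof -
  have M: "M \<in> space (prob_algebra M)"
    using assms by (auto simp: space_prob_algebra)
  have k: "(\<lambda>x. distr (L x) (M \<Otimes>\<^sub>M N) (Pair x)) \<in> M \<rightarrow>\<^sub>M prob_algebra (M \<Otimes>\<^sub>M N)"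
    by measurable
  show "prob_space (joint M N L)" "sets (joint M N L) = sets (M \<Otimes>\<^sub>M N)"
    unfolding joint_def by (rule prob_space_bind'[OF M k] sets_bind'[OF M k])+
  show "distr (joint M N L) N snd = M \<bind> L"
    unfolding joint_def by (rule distr_bind_distr[OF assms]) auto
qed

lemma
  assumes "prob_space N" and L[measurable]: "L \<in> N \<rightarrow>\<^sub>M prob_algebra M"
  shows prob_space_joint_rev: "prob_space (joint_rev M N L)"
    and sets_joint_rev: "sets (joint_rev M N L) = sets (M \<Otimes>\<^sub>M N)"
    and distr_joint_rev_fst: "distr (joint_rev M N L) M fst = N \<bind> L"
proof -
  have N: "N \<in> space (prob_algebra N)"
    using assms by (auto simp: space_prob_algebra)
  have k: "(\<lambda>y. distr (L y) (M \<Otimes>\<^sub>M N) (\<lambda>x. (x, y))) \<in> N \<rightarrow>\<^sub>M prob_algebra (M \<Otimes>\<^sub>M N)"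
    by measurable
  show "prob_space (joint_rev M N L)" "sets (joint_rev M N L) = sets (M \<Otimes>\<^sub>M N)"
    unfolding joint_rev_def by (rule prob_space_bind'[OF N k] sets_bind'[OF N k])+
  show "distr (joint_rev M N L) M fst = N \<bind> L"
    unfolding joint_rev_def by (rule distr_bind_distr[OF assms]) auto
qed

text \<open>Needed to compare a Bayes formula with the next bridge, which keeps the transition and
  changes its starting law. The change of measure then depends on the starting coordinate
  alone.\<close>

lemma joint_density:
  fixes g :: "'a \<Rightarrow> real"
  assumes "prob_space M" "L \<in> M \<rightarrow>\<^sub>M prob_algebra N" "g \<in> borel_measurable M" "prob_space (density M g)"
  shows "joint (density M g) N L = density (joint M N L) (\<lambda>z. g (fst z))"
proof -
  have "joint (density M g) N L = density M g \<bind> (\<lambda>x. distr (L x) (M \<Otimes>\<^sub>M N) (Pair x))"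
    unfolding joint_def by (intro bind_cong refl distr_cong sets_pair_measure_cong) auto
  also have "\<dots> = density (joint M N L) (\<lambda>z. g (fst z))"
    unfolding joint_def by (rule density_bind_distr[OF assms(1,2) _ _ _ assms(3,4)]) auto
  finally show ?thesis .
qed

lemma joint_rev_density:
  fixes g :: "'b \<Rightarrow> real"
  assumes "prob_space N" "L \<in> N \<rightarrow>\<^sub>M prob_algebra M" "g \<in> borel_measurable N" "prob_space (density N g)"
  shows "joint_rev M (density N g) L = density (joint_rev M N L) (\<lambda>z. g (snd z))"
proof -
  have "joint_rev M (density N g) L = density N g \<bind> (\<lambda>y. distr (L y) (M \<Otimes>\<^sub>M N) (\<lambda>x. (x, y)))"
    unfolding joint_rev_def by (intro bind_cong refl distr_cong sets_pair_measure_cong) auto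
  also have "\<dots> = density (joint_rev M N L) (\<lambda>z. g (snd z))"
    unfolding joint_rev_def by (rule density_bind_distr[OF assms(1,2) _ _ _ assms(3,4)]) auto
  finally show ?thesis .
qed

section \<open>Entropy lost in one Bayes half-step\<close>

text \<open>The chain rule is applied along \<open>snd\<close>, under which \<open>Q\<close> and the
  joint law have the images \<eta> and \<open>\<mu> \<bind> A\<close>. Tilting by the density of
  \<eta> relative to \<open>\<mu> \<bind> A\<close> replaces the starting law of the reversed
  disintegration by \<eta>, which yields exactly \<open>joint_rev \<mu> \<eta> B\<close>. Finiteness
  is part of the conclusion because it feeds the next half-step.\<close>

lemma relative_entropy_joint_Bayes:
  assumes "prob_space \<mu>" "prob_space \<eta>" and A: "A \<in> \<mu> \<rightarrow>\<^sub>M prob_algebra \<eta>" and B: "B \<in> \<eta> \<rightarrow>\<^sub>M prob_algebra \<mu>"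
    and Bayes: "joint \<mu> \<eta> A = joint_rev \<mu> (\<mu> \<bind> A) B"
    and Q: "Q \<in> couplings \<mu> \<eta>" and fin: "relative_entropy Q (joint \<mu> \<eta> A) < \<infinity>"
  shows "relative_entropy Q (joint \<mu> \<eta> A) =
      relative_entropy \<eta> (\<mu> \<bind> A) + relative_entropy Q (joint_rev \<mu> \<eta> B)"
    and "relative_entropy \<eta> (\<mu> \<bind> A) < \<infinity>"
    and "relative_entropy Q (joint_rev \<mu> \<eta> B) < \<infinity>"
proof -
  have \<mu>: "\<mu> \<in> space (prob_algebra \<mu>)"
    using assms by (auto simp: space_prob_algebra)
  have \<pi>: "prob_space (\<mu> \<bind> A)" and sets_\<pi>: "sets (\<mu> \<bind> A) = sets \<eta>"
    using prob_space_bind'[OF \<mu> A] sets_bind'[OF \<mu> A] by auto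
  have P: "prob_space (joint \<mu> \<eta> A)" "sets (joint \<mu> \<eta> A) = sets (\<mu> \<Otimes>\<^sub>M \<eta>)"
    using prob_space_joint[OF assms(1) A] sets_joint[OF assms(1) A] by auto
  have Q': "prob_space Q" "sets Q = sets (joint \<mu> \<eta> A)" "distr Q \<eta> snd = \<eta>"
    using Q P by (auto simp: couplings_def)
  have snd: "snd \<in> joint \<mu> \<eta> A \<rightarrow>\<^sub>M \<eta>"
    by (simp add: P cong: measurable_cong_sets)
  obtain g :: "'b \<Rightarrow> real" where g: "g \<in> borel_measurable \<eta>" "\<And>y. 0 \<le> g y" "\<eta> = density (\<mu> \<bind> A) g"
    and H: "relative_entropy Q (joint \<mu> \<eta> A) = relative_entropy \<eta> (\<mu> \<bind> A) +
        relative_entropy Q (density (joint \<mu> \<eta> A) (\<lambda>z. g (snd z)))"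
      "relative_entropy \<eta> (\<mu> \<bind> A) < \<infinity>"
      "relative_entropy Q (density (joint \<mu> \<eta> A) (\<lambda>z. g (snd z))) < \<infinity>"
    using relative_entropy_chain[OF P(1) Q'(1,2) snd fin]
    unfolding Q'(3) distr_joint_snd[OF assms(1) A] by blast
  have "joint_rev \<mu> \<eta> B = joint_rev \<mu> (density (\<mu> \<bind> A) g) B"
    using g(3) by simp
  also have "\<dots> = density (joint_rev \<mu> (\<mu> \<bind> A) B) (\<lambda>z. g (snd z))"
    using \<pi> sets_\<pi> B g assms(2) by (intro joint_rev_density) (simp_all cong: measurable_cong_sets)
  finally have "joint_rev \<mu> \<eta> B = density (joint \<mu> \<eta> A) (\<lambda>z. g (snd z))"
    by (simp add: Bayes)
  with H show "relative_entropy Q (joint \<mu> \<eta> A) =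
      relative_entropy \<eta> (\<mu> \<bind> A) + relative_entropy Q (joint_rev \<mu> \<eta> B)"
    and "relative_entropy \<eta> (\<mu> \<bind> A) < \<infinity>"
    and "relative_entropy Q (joint_rev \<mu> \<eta> B) < \<infinity>"
    by simp_all
qed

text \<open>Mirror image of the previous half-step: the chain rule runs along \<open>fst\<close>,
  and the tilt restores the first marginal \<mu>.\<close>

lemma relative_entropy_joint_rev_Bayes:
  assumes "prob_space \<mu>" "prob_space \<eta>" and A: "A \<in> \<mu> \<rightarrow>\<^sub>M prob_algebra \<eta>" and B: "B \<in> \<eta> \<rightarrow>\<^sub>M prob_algebra \<mu>"
    and Bayes: "joint_rev \<mu> \<eta> B = joint (\<eta> \<bind> B) \<eta> A"
    and Q: "Q \<in> couplings \<mu> \<eta>" and fin: "relative_entropy Q (joint_rev \<mu> \<eta> B) < \<infinity>"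
  shows "relative_entropy Q (joint_rev \<mu> \<eta> B) =
      relative_entropy \<mu> (\<eta> \<bind> B) + relative_entropy Q (joint \<mu> \<eta> A)"
    and "relative_entropy \<mu> (\<eta> \<bind> B) < \<infinity>"
    and "relative_entropy Q (joint \<mu> \<eta> A) < \<infinity>"
proof -
  have \<eta>: "\<eta> \<in> space (prob_algebra \<eta>)"
    using assms by (auto simp: space_prob_algebra)
  have \<pi>: "prob_space (\<eta> \<bind> B)" and sets_\<pi>: "sets (\<eta> \<bind> B) = sets \<mu>"
    using prob_space_bind'[OF \<eta> B] sets_bind'[OF \<eta> B] by auto
  have P: "prob_space (joint_rev \<mu> \<eta> B)" "sets (joint_rev \<mu> \<eta> B) = sets (\<mu> \<Otimes>\<^sub>M \<eta>)"
    using prob_space_joint_rev[OF assms(2) B] sets_joint_rev[OF assms(2) B] by auto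
  have Q': "prob_space Q" "sets Q = sets (joint_rev \<mu> \<eta> B)" "distr Q \<mu> fst = \<mu>"
    using Q P by (auto simp: couplings_def)
  have fst: "fst \<in> joint_rev \<mu> \<eta> B \<rightarrow>\<^sub>M \<mu>"
    by (simp add: P cong: measurable_cong_sets)
  obtain g :: "'a \<Rightarrow> real" where g: "g \<in> borel_measurable \<mu>" "\<And>y. 0 \<le> g y" "\<mu> = density (\<eta> \<bind> B) g"
    and H: "relative_entropy Q (joint_rev \<mu> \<eta> B) = relative_entropy \<mu> (\<eta> \<bind> B) +
        relative_entropy Q (density (joint_rev \<mu> \<eta> B) (\<lambda>z. g (fst z)))"
      "relative_entropy \<mu> (\<eta> \<bind> B) < \<infinity>"
      "relative_entropy Q (density (joint_rev \<mu> \<eta> B) (\<lambda>z. g (fst z))) < \<infinity>"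
    using relative_entropy_chain[OF P(1) Q'(1,2) fst fin]
    unfolding Q'(3) distr_joint_rev_fst[OF assms(2) B] by blast
  have "joint \<mu> \<eta> A = joint (density (\<eta> \<bind> B) g) \<eta> A"
    using g(3) by simp
  also have "\<dots> = density (joint (\<eta> \<bind> B) \<eta> A) (\<lambda>z. g (fst z))"
    using \<pi> sets_\<pi> A g assms(1) by (intro joint_density) (simp_all cong: measurable_cong_sets)
  finally have "joint \<mu> \<eta> A = density (joint_rev \<mu> \<eta> B) (\<lambda>z. g (fst z))"
    by (simp add: Bayes)
  with H show "relative_entropy Q (joint_rev \<mu> \<eta> B) =
      relative_entropy \<mu> (\<eta> \<bind> B) + relative_entropy Q (joint \<mu> \<eta> A)"
    and "relative_entropy \<mu> (\<eta> \<bind> B) < \<infinity>"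
    and "relative_entropy Q (joint \<mu> \<eta> A) < \<infinity>"
    by simp_all
qed

subsection \<open>Existence of entropy minimizers\<close>

text \<open>The bound ln s \<le> s - 1 is used at s = sqrt c / sqrt x rather than at c / x.
  Multiplied by 2x, it improves the tangent inequality of t ln t at c by a squared gap of Hellinger
  type.\<close>

lemma mult_ln_ge_tangent:
  fixes x c :: real
  assumes "0 \<le> x" "0 < c"
  shows "c * ln c + (1 + ln c) * (x - c) + (sqrt x - sqrt c)\<^sup>2 \<le> x * ln x"
proof (cases "x = 0")
  case True
  with assms show ?thesis by (simp add: algebra_simps)
next
  case False
  with assms have x: "0 < x" by simp
  have "ln (sqrt c / sqrt x) \<le> sqrt c / sqrt x - 1"
    using x assms by (intro ln_le_minus_one) simp
  then have "2 * x * (ln c / 2 - ln x / 2) \<le> 2 * x * (sqrt c / sqrt x - 1)"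
    using x assms by (intro mult_left_mono) (auto simp: ln_div ln_sqrt)
  also have "\<dots> = 2 * (x / sqrt x * sqrt c) - 2 * x"
    using x by (simp add: field_simps)
  also have "x / sqrt x = sqrt x"
    using x by (simp add: real_div_sqrt)
  finally show ?thesis
    using assms by (simp add: power2_diff algebra_simps)
qed

text \<open>Adding the tangent inequalities at the midpoint c for a and b cancels the linear terms
  and leaves two squared gaps of roots. The free parameter \<epsilon> trades these gaps for |a - b|;
  it will be matched to the precision of a minimizing sequence, and \<epsilon> = 0 is plain midpoint
  convexity.\<close>

lemma mult_ln_midpoint:
  fixes a b \<epsilon> :: real
  assumes "0 \<le> a" "0 \<le> b"
  shows "\<epsilon> * \<bar>a - b\<bar> \<le> a * ln a + b * ln b - 2 * ((a + b) / 2 * ln ((a + b) / 2)) + \<epsilon>\<^sup>2 * (a + b)"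
proof (cases "a + b = 0")
  case True
  with assms have "a = 0" "b = 0" by auto
  then show ?thesis by simp
next
  case False
  define c where "c = (a + b) / 2"
  with assms False have c: "0 < c" by auto
  have *: "\<epsilon> * \<bar>x - c\<bar> \<le> (sqrt x - sqrt c)\<^sup>2 + \<epsilon>\<^sup>2 * ((x + c) / 2)" if "0 \<le> x" for x
  proof -
    define u v where "u = \<bar>sqrt x - sqrt c\<bar>" and "v = sqrt x + sqrt c"
    \<comment> \<open>Young's inequality for the factorization |x - c| = u v. The weight 1/2 makes
      the errors for a and b add up to \<epsilon>^2 (a + b).\<close>
    have "0 \<le> (u - \<epsilon> * v / 2)\<^sup>2" by simp
    then have "\<epsilon> * (u * v) \<le> u\<^sup>2 + \<epsilon>\<^sup>2 * (v\<^sup>2 / 4)"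
      by (simp add: power2_eq_square algebra_simps)
    moreover have "x - c = (sqrt x - sqrt c) * v"
      using that c by (simp add: v_def algebra_simps)
    then have "\<bar>x - c\<bar> = u * v"
      using that c by (simp add: u_def v_def abs_mult)
    moreover have "v\<^sup>2 \<le> 2 * (x + c)"
      using that c sum_squares_bound[of "sqrt x" "sqrt c"] by (simp add: v_def power2_sum)
    then have "\<epsilon>\<^sup>2 * (v\<^sup>2 / 4) \<le> \<epsilon>\<^sup>2 * ((x + c) / 2)"
      by (intro mult_left_mono) auto
    ultimately show ?thesis by (simp add: u_def)
  qed
  have "2 * (c * ln c) + (sqrt a - sqrt c)\<^sup>2 + (sqrt b - sqrt c)\<^sup>2 \<le> a * ln a + b * ln b"
    using mult_ln_ge_tangent[OF assms(1) c] mult_ln_ge_tangent[OF assms(2) c]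
    by (simp add: c_def algebra_simps) (simp add: field_simps)
  moreover have "\<epsilon> * \<bar>a - b\<bar> = \<epsilon> * \<bar>a - c\<bar> + \<epsilon> * \<bar>b - c\<bar>"
  proof -
    have "\<bar>a - b\<bar> = \<bar>a - c\<bar> + \<bar>b - c\<bar>" by (auto simp: c_def abs_if field_simps)
    then show ?thesis by (simp add: algebra_simps)
  qed
  moreover have "\<epsilon>\<^sup>2 * ((a + c) / 2) + \<epsilon>\<^sup>2 * ((b + c) / 2) = \<epsilon>\<^sup>2 * (a + b)"
    by (simp add: c_def algebra_simps add_divide_distrib)
  ultimately show ?thesis
    using *[OF assms(1)] *[OF assms(2)] unfolding c_def[symmetric] by linarith
qed

text \<open>Away from 0 this is continuity of ln. At 0 the right-hand limit of t ln t agrees with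
  the value 0 * ln 0 = 0, and nonnegativity keeps the sequence on that side.\<close>

lemma tendsto_mult_ln:
  fixes l :: real
  assumes "X \<longlonglongrightarrow> l" "\<And>n. 0 \<le> X n"
  shows "(\<lambda>n. X n * ln (X n)) \<longlonglongrightarrow> l * ln l"
proof (cases "l = 0")
  case False
  then show ?thesis
    using assms(1) by (intro tendsto_intros)
next
  case True
  have "((\<lambda>t::real. t * ln t) \<longlongrightarrow> 0) (at_right 0)"
    by real_asymp
  then have "((\<lambda>t::real. t * ln t) \<longlongrightarrow> 0 * ln 0) (at 0 within {0..})"
    by (simp add: at_within_Ici_at_right)
  then have "continuous (at 0 within {0..}) (\<lambda>t::real. t * ln t)"
    by (simp add: continuous_within)
  then show ?thesis
    using assms True unfolding continuous_within_sequentially comp_def by auto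
qed

text \<open>As in the Riesz-Fischer theorem, summing under the integral shows that the increments
  are absolutely summable at almost every point, and the sequence is recovered from them by
  telescoping.\<close>

lemma AE_convergent_of_summable_L1_dist:
  fixes F :: "nat \<Rightarrow> 'a \<Rightarrow> real"
  assumes [measurable]: "\<And>n. F n \<in> borel_measurable M"
    and "(\<Sum>n. \<integral>\<^sup>+x. ennreal \<bar>F n x - F (Suc n) x\<bar> \<partial>M) \<noteq> \<infinity>"
  shows "AE x in M. convergent (\<lambda>n. F n x)"
proof -
  have "(\<integral>\<^sup>+x. (\<Sum>n. ennreal \<bar>F n x - F (Suc n) x\<bar>) \<partial>M) \<noteq> \<infinity>"
    using assms(2) by (subst nn_integral_suminf) auto
  then have "AE x in M. (\<Sum>n. ennreal \<bar>F n x - F (Suc n) x\<bar>) \<noteq> \<infinity>"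
    by (intro nn_integral_PInf_AE) auto
  then show ?thesis
  proof eventually_elim
    case (elim x)
    then have "summable (\<lambda>n. \<bar>F n x - F (Suc n) x\<bar>)"
      by (intro summable_suminf_not_top) auto
    then have "summable (\<lambda>n. F n x - F (Suc n) x)"
      by (rule summable_rabs_cancel)
    then have "convergent (\<lambda>n. F 0 x - F n x)"
      unfolding summable_iff_convergent sum_lessThan_telescope'[of "\<lambda>n. F n x"] .
    then show ?case
      using convergent_diff[OF convergent_const[of "F 0 x"]] by fastforce
  qed
qed

text \<open>Csiszar's argument: by uniform convexity of \<open>t \<mapsto> t ln t\<close>, the densities of a minimizing
  sequence form a Cauchy sequence in \<open>L\<^sup>1\<close>, and the entropy is lower semicontinuous by Fatou's lemma.\<close>

lemma relative_entropy_minimizer_exists: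
  fixes P :: "'a measure"
  assumes "prob_space P"
    and C: "\<And>Q. Q \<in> C \<Longrightarrow> prob_space Q" "\<And>Q. Q \<in> C \<Longrightarrow> sets Q = sets P"
    and mid: "\<And>f g :: 'a \<Rightarrow> real. \<lbrakk>f \<in> borel_measurable P; g \<in> borel_measurable P; \<And>x. 0 \<le> f x; \<And>x. 0 \<le> g x;
        density P f \<in> C; density P g \<in> C\<rbrakk> \<Longrightarrow> density P (\<lambda>x. (f x + g x) / 2) \<in> C"
    and closed: "\<And>(F :: nat \<Rightarrow> 'a \<Rightarrow> real) f. \<lbrakk>\<And>n. F n \<in> borel_measurable P; f \<in> borel_measurable P;
        \<And>n x. 0 \<le> F n x; \<And>x. 0 \<le> f x; \<And>n. density P (F n) \<in> C;
        (\<lambda>n. \<integral>\<^sup>+x. ennreal \<bar>F n x - f x\<bar> \<partial>P) \<longlonglongrightarrow> 0\<rbrakk> \<Longrightarrow> density P f \<in> C"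
    and ex: "\<exists>Q\<in>C. relative_entropy Q P < \<infinity>"
  shows "\<exists>Q\<in>C. \<forall>R\<in>C. relative_entropy Q P \<le> relative_entropy R P"
proof -
  interpret P: prob_space P by fact
  define J where "J f = (\<integral>x. f x * ln (f x) \<partial>P)" for f :: "'a \<Rightarrow> real"
  \<comment> \<open>\<open>S\<close> consists of the densities of members of \<open>C\<close> with
    finite entropy. On it the entropy is the real number \<open>J f\<close>, so its infimum can be
    taken in the reals.\<close>
  define S where "S = {f :: 'a \<Rightarrow> real. f \<in> borel_measurable P \<and> (\<forall>x. 0 \<le> f x) \<and> density P f \<in> C \<and>
    integrable P (\<lambda>x. f x * ln (f x))}"
  have SD: "f \<in> borel_measurable P" "\<And>x. 0 \<le> f x" "density P f \<in> C"
    "integrable P (\<lambda>x. f x * ln (f x))" if "f \<in> S" for f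
    using that by (auto simp: S_def)
  have H: "relative_entropy (density P f) P = ereal (J f)" if "f \<in> S" for f
    using SD[OF that] relative_entropy_density[OF \<open>prob_space P\<close>, of f]
    by (simp add: integrable_real_density integral_real_density J_def)
  have J_nonneg: "0 \<le> J f" if "f \<in> S" for f
    using relative_entropy_nonneg[OF \<open>prob_space P\<close> C(1,2)[OF SD(3)[OF that]]] H[OF that] by simp
  have S_ex: "\<exists>f\<in>S. R = density P f" if R: "R \<in> C" "relative_entropy R P < \<infinity>" for R
  proof -
    obtain f :: "'a \<Rightarrow> real" where f: "f \<in> borel_measurable P" "\<And>x. 0 \<le> f x" "R = density P f"
      "integrable R (\<lambda>x. ln (f x))"
      using relative_entropy_finiteE[OF \<open>prob_space P\<close> C[OF R(1)] R(2)] by blast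
    then have "f \<in> S"
      using R by (simp add: S_def integrable_real_density)
    with f show ?thesis by blast
  qed
  have S_ne: "S \<noteq> {}"
    using ex S_ex by blast
  define I where "I = Inf (J ` S)"
  have bdd: "bdd_below (J ` S)"
    using J_nonneg by (intro bdd_belowI[of _ 0]) auto
  have I_le: "I \<le> J f" if "f \<in> S" for f
    unfolding I_def using that bdd by (intro cInf_lower) auto
  \<comment> \<open>Excess entropy below \<open>(e n)\<^sup>2 / 2\<close> will give L1 increments of
    at most \<open>3 * e n\<close>. The geometric rate makes these summable, hence no subsequence
    has to be extracted.\<close>
  define e :: "nat \<Rightarrow> real" where "e n = (1/2) ^ n" for n
  have e_pos: "0 < e n" for n by (simp add: e_def)
  have e_mono: "e m \<le> e n" if "n \<le> m" for n m
    using that by (simp add: e_def power_decreasing)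
  have e_lim: "e \<longlonglongrightarrow> 0"
    unfolding e_def by (intro LIMSEQ_power_zero) simp
  have "\<exists>f\<in>S. J f < I + (e n)\<^sup>2 / 2" for n
    using cInf_lessD[of "J ` S" "I + (e n)\<^sup>2 / 2"] S_ne e_pos[of n] by (auto simp: I_def)
  then obtain F where F: "\<And>n. F n \<in> S" and JF: "\<And>n. J (F n) < I + (e n)\<^sup>2 / 2"
    by metis
  have Fm[measurable]: "\<And>n. F n \<in> borel_measurable P" and F0: "\<And>n x. 0 \<le> F n x"
    and FC: "\<And>n. density P (F n) \<in> C" and Fi: "\<And>n. integrable P (\<lambda>x. F n x * ln (F n x))"
    using SD[OF F] by auto
  have F1: "integrable P (F n)" "(\<integral>x. F n x \<partial>P) = 1" for n
    using integrable_prob_density[OF C(1)[OF FC]] F0 by auto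
  have Cauchy: "(\<integral>\<^sup>+x. ennreal \<bar>F n x - F m x\<bar> \<partial>P) \<le> ennreal (3 * e n)" if "n \<le> m" for n m
  proof -
    define G where "G x = (F n x + F m x) / 2" for x
    have [measurable]: "G \<in> borel_measurable P"
      unfolding G_def[abs_def] by measurable
    have G0: "0 \<le> G x" for x
      by (simp add: G_def F0)
    \<comment> \<open>Midpoint convexity, the case \<epsilon> = 0, bounds G ln G from above; the
      tangent bound G ln G \<ge> G - 1 \<ge> -1 bounds it from below.\<close>
    have "integrable P (\<lambda>x. G x * ln (G x))"
    proof (rule Bochner_Integration.integrable_bound)
      show "integrable P (\<lambda>x. 1 + \<bar>F n x * ln (F n x)\<bar> + \<bar>F m x * ln (F m x)\<bar>)"
        using Fi by auto
      have "\<bar>G x * ln (G x)\<bar> \<le> 1 + \<bar>F n x * ln (F n x)\<bar> + \<bar>F m x * ln (F m x)\<bar>" for x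
        using mult_ln_midpoint[of "F n x" "F m x" 0] F0 mult_ln_ge[OF G0[of x]] G0[of x]
        by (simp add: G_def[symmetric])
      then show "AE x in P. norm (G x * ln (G x)) \<le> norm (1 + \<bar>F n x * ln (F n x)\<bar> + \<bar>F m x * ln (F m x)\<bar>)"
        unfolding real_norm_def by (intro AE_I2 order_trans[OF _ abs_ge_self])
    qed simp
    then have G: "G \<in> S"
      using mid[OF Fm Fm F0 F0 FC FC, of n m] G0 by (simp add: S_def G_def[abs_def])
    have "e n * (\<integral>x. \<bar>F n x - F m x\<bar> \<partial>P) = (\<integral>x. e n * \<bar>F n x - F m x\<bar> \<partial>P)"
      by simp
    also have "\<dots> \<le> (\<integral>x. F n x * ln (F n x) + F m x * ln (F m x) - 2 * (G x * ln (G x)) + (e n)\<^sup>2 * (F n x + F m x) \<partial>P)"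
    proof (rule integral_mono)
      show "e n * \<bar>F n x - F m x\<bar> \<le>
          F n x * ln (F n x) + F m x * ln (F m x) - 2 * (G x * ln (G x)) + (e n)\<^sup>2 * (F n x + F m x)" for x
        unfolding G_def by (intro mult_ln_midpoint F0)
    qed (use F1 Fi SD(4)[OF G] in auto)
    also have "\<dots> = J (F n) + J (F m) - 2 * J G + 2 * (e n)\<^sup>2"
      using F1 Fi SD(4)[OF G] by (simp add: J_def)
    \<comment> \<open>The midpoint is again admissible, so \<open>J G\<close> is at least
      \<open>I\<close> and the convexity gap is at most \<open>(e n)\<^sup>2\<close>. The remaining
      \<open>2 * (e n)\<^sup>2\<close> is the \<epsilon> error for two densities of mass 1.\<close>
    also have "\<dots> \<le> 3 * (e n)\<^sup>2"
      using JF[of n] JF[of m] I_le[OF G] power_mono[OF e_mono[OF that], of 2] e_pos[of m] by simp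
    finally have "(\<integral>x. \<bar>F n x - F m x\<bar> \<partial>P) \<le> 3 * e n"
      using e_pos[of n] by (simp add: power2_eq_square)
    then show ?thesis
      using F1 by (subst nn_integral_eq_integral) (auto intro: ennreal_leI)
  qed
  have "(\<Sum>n. \<integral>\<^sup>+x. ennreal \<bar>F n x - F (Suc n) x\<bar> \<partial>P) \<le> (\<Sum>n. ennreal (3 * e n))"
    by (intro suminf_le Cauchy) auto
  also have "\<dots> < \<infinity>"
    using e_pos by (subst suminf_ennreal2) (auto simp: e_def less_imp_le intro!: summable_mult)
  finally have conv: "AE x in P. convergent (\<lambda>n. F n x)"
    by (intro AE_convergent_of_summable_L1_dist Fm) (auto simp: top_unique)
  \<comment> \<open>Off the convergence set \<open>lim\<close> is an arbitrary value; the maximum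
    makes \<open>f\<close> nonnegative everywhere without changing it where the sequence
    converges.\<close>
  define f where "f x = max 0 (lim (\<lambda>n. F n x))" for x
  have [measurable]: "f \<in> borel_measurable P"
    unfolding f_def[abs_def] by measurable
  have f0: "0 \<le> f x" for x
    by (simp add: f_def)
  have lim: "AE x in P. (\<lambda>n. F n x) \<longlonglongrightarrow> f x"
    using conv
  proof eventually_elim
    case (elim x)
    then have "(\<lambda>n. F n x) \<longlonglongrightarrow> lim (\<lambda>n. F n x)"
      by (simp add: convergent_LIMSEQ_iff)
    moreover from this have "0 \<le> lim (\<lambda>n. F n x)"
      by (rule LIMSEQ_le_const) (use F0 in auto)
    ultimately show ?case by (simp add: f_def)
  qed
  \<comment> \<open>Fatou's lemma in \<open>m\<close> with \<open>n\<close> fixed carries the Cauchy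
    bound over to the limit.\<close>
  have L1: "(\<integral>\<^sup>+x. ennreal \<bar>F n x - f x\<bar> \<partial>P) \<le> ennreal (3 * e n)" for n
  proof -
    have "(\<integral>\<^sup>+x. ennreal \<bar>F n x - f x\<bar> \<partial>P) = (\<integral>\<^sup>+x. liminf (\<lambda>m. ennreal \<bar>F n x - F m x\<bar>) \<partial>P)"
    proof (rule nn_integral_cong_AE, use lim in eventually_elim)
      case (elim x)
      then have "(\<lambda>m. ennreal \<bar>F n x - F m x\<bar>) \<longlonglongrightarrow> ennreal \<bar>F n x - f x\<bar>"
        by (intro tendsto_intros)
      then show ?case
        by (intro lim_imp_Liminf[symmetric]) auto
    qed
    also have "\<dots> \<le> liminf (\<lambda>m. \<integral>\<^sup>+x. ennreal \<bar>F n x - F m x\<bar> \<partial>P)"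
      by (rule nn_integral_liminf) measurable
    also have "\<dots> \<le> liminf (\<lambda>m. ennreal (3 * e n))"
      using Cauchy by (intro Liminf_mono eventually_sequentiallyI[of n]) auto
    also have "\<dots> = ennreal (3 * e n)"
      by (simp add: Liminf_const)
    finally show ?thesis .
  qed
  have "(\<lambda>n. ennreal (3 * e n)) \<longlonglongrightarrow> ennreal (3 * 0)"
    by (intro tendsto_intros e_lim)
  then have "(\<lambda>n. ennreal (3 * e n)) \<longlonglongrightarrow> 0"
    by simp
  then have "(\<lambda>n. \<integral>\<^sup>+x. ennreal \<bar>F n x - f x\<bar> \<partial>P) \<longlonglongrightarrow> 0"
    by (rule tendsto_sandwich[OF _ _ tendsto_const, rotated 2]) (use L1 in simp_all)
  then have fC: "density P f \<in> C"
    using closed[of F f] F0 f0 FC by simp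
  \<comment> \<open>Fatou's lemma needs a nonnegative integrand, so 1 is added to t ln t. On a
    probability space this shifts every entropy by exactly 1.\<close>
  have ge: "0 \<le> 1 + t * ln t" if "0 \<le> t" for t :: real
    using mult_ln_ge[OF that] that by simp
  have I0: "0 \<le> I"
    unfolding I_def using S_ne J_nonneg by (intro cInf_greatest) auto
  have "(\<integral>\<^sup>+x. ennreal (1 + f x * ln (f x)) \<partial>P) = (\<integral>\<^sup>+x. liminf (\<lambda>n. ennreal (1 + F n x * ln (F n x))) \<partial>P)"
  proof (rule nn_integral_cong_AE, use lim in eventually_elim)
    case (elim x)
    then have "(\<lambda>n. ennreal (1 + F n x * ln (F n x))) \<longlonglongrightarrow> ennreal (1 + f x * ln (f x))"
      using F0 by (intro tendsto_ennrealI tendsto_add tendsto_const tendsto_mult_ln)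
    then show ?case
      by (intro lim_imp_Liminf[symmetric]) auto
  qed
  also have "\<dots> \<le> liminf (\<lambda>n. \<integral>\<^sup>+x. ennreal (1 + F n x * ln (F n x)) \<partial>P)"
    by (rule nn_integral_liminf) measurable
  also have "\<dots> = liminf (\<lambda>n. ennreal (1 + J (F n)))"
    using Fi ge F0 by (subst nn_integral_eq_integral) (auto simp: J_def P.prob_space)
  also have "\<dots> \<le> liminf (\<lambda>n. ennreal (1 + (I + (e n)\<^sup>2 / 2)))"
    using JF by (intro Liminf_mono always_eventually allI ennreal_leI) (simp add: less_imp_le)
  also have "\<dots> = ennreal (1 + (I + 0\<^sup>2 / 2))"
    by (intro lim_imp_Liminf tendsto_intros e_lim) auto
  finally have Fatou: "(\<integral>\<^sup>+x. ennreal (1 + f x * ln (f x)) \<partial>P) \<le> ennreal (1 + I)"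
    by simp
  then have "integrable P (\<lambda>x. 1 + f x * ln (f x))"
    using ge f0 by (intro integrableI_nonneg) (auto simp: le_less_trans)
  then have fi: "integrable P (\<lambda>x. f x * ln (f x))"
    using Bochner_Integration.integrable_diff[of P "\<lambda>x. 1 + f x * ln (f x)" "\<lambda>x. 1"] by simp
  then have fS: "f \<in> S"
    using fC f0 by (simp add: S_def)
  have "ennreal (1 + J f) \<le> ennreal (1 + I)"
    using Fatou fi ge f0 by (subst (asm) nn_integral_eq_integral) (auto simp: J_def P.prob_space)
  then have "J f \<le> I"
    using I0 J_nonneg[OF fS] by (simp add: ennreal_le_iff)
  then have "relative_entropy (density P f) P \<le> relative_entropy R P" if R: "R \<in> C" for R
  proof (cases "relative_entropy R P < \<infinity>")
    case True
    then obtain r where "r \<in> S" "R = density P r"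
      using S_ex R by blast
    then show ?thesis
      using \<open>J f \<le> I\<close> I_le[of r] H[OF fS] H[of r] by simp
  qed auto
  with fC show ?thesis by blast
qed

subsection \<open>Couplings and the Schroedinger bridge\<close>

lemma emeasure_distr_density:
  fixes h :: "'a \<Rightarrow> real"
  assumes h: "integrable P h" "\<And>x. 0 \<le> h x" and [measurable]: "T \<in> P \<rightarrow>\<^sub>M N" "E \<in> sets N"
  shows "emeasure (distr (density P h) N T) E = ennreal (\<integral>x. h x * indicator E (T x) \<partial>P)"
proof -
  have [measurable]: "h \<in> borel_measurable P"
    using h by auto
  have "emeasure (distr (density P h) N T) E = (\<integral>\<^sup>+y. indicator E y \<partial>distr (density P h) N T)"
    by simp
  also have "\<dots> = (\<integral>\<^sup>+x. ennreal (h x) * indicator E (T x) \<partial>P)"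
    by (subst nn_integral_distr) (auto simp: nn_integral_density)
  also have "\<dots> = (\<integral>\<^sup>+x. ennreal (h x * indicator E (T x)) \<partial>P)"
    by (intro nn_integral_cong) (auto simp: indicator_def)
  also have "\<dots> = ennreal (\<integral>x. h x * indicator E (T x) \<partial>P)"
    using h by (intro nn_integral_eq_integral Bochner_Integration.integrable_bound[OF h(1)])
      (auto simp: indicator_def)
  finally show ?thesis .
qed

text \<open>For real densities the marginal conditions become linear equations between integrals,
  from which convexity and closedness in L1 can be read off. Integrability is listed separately
  because a nonintegrable function has Bochner integral 0; total mass 1 follows from the first
  marginal.\<close>

lemma density_in_couplings_iff:
  fixes h :: "'a \<times> 'b \<Rightarrow> real"
  assumes "prob_space \<mu>" "prob_space \<eta>" and P: "sets P = sets (\<mu> \<Otimes>\<^sub>M \<eta>)"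
    and [measurable]: "h \<in> borel_measurable P" and h0: "\<And>z. 0 \<le> h z"
  shows "density P h \<in> couplings \<mu> \<eta> \<longleftrightarrow> integrable P h \<and>
    (\<forall>E\<in>sets \<mu>. (\<integral>z. h z * indicator E (fst z) \<partial>P) = measure \<mu> E) \<and>
    (\<forall>E\<in>sets \<eta>. (\<integral>z. h z * indicator E (snd z) \<partial>P) = measure \<eta> E)" (is "?L \<longleftrightarrow> ?R")
proof -
  interpret \<mu>: prob_space \<mu> by fact
  interpret \<eta>: prob_space \<eta> by fact
  have fst: "fst \<in> P \<rightarrow>\<^sub>M \<mu>" and snd: "snd \<in> P \<rightarrow>\<^sub>M \<eta>"
    by (simp_all add: P cong: measurable_cong_sets)
  have nonneg: "0 \<le> (\<integral>z. h z * indicator E (T z) \<partial>P)" for E :: "'c set" and T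
    using h0 by (intro integral_nonneg_AE) auto
  have prob: "prob_space (density P h)" if "integrable P h" "distr (density P h) \<mu> fst = \<mu>"
  proof -
    have "prob_space (distr (density P h) \<mu> fst)"
      using that(2) assms(1) by simp
    then show ?thesis
      by (rule prob_space_distrD[rotated]) (use fst in simp)
  qed
  have int: "integrable P h" if ?L
    using that by (intro integrable_prob_density(1)) (auto simp: couplings_def h0)
  have fst_iff: "distr (density P h) \<mu> fst = \<mu> \<longleftrightarrow>
      (\<forall>E\<in>sets \<mu>. (\<integral>z. h z * indicator E (fst z) \<partial>P) = measure \<mu> E)" if i: "integrable P h"
  proof -
    have "distr (density P h) \<mu> fst = \<mu> \<longleftrightarrow> (\<forall>E\<in>sets \<mu>. emeasure (distr (density P h) \<mu> fst) E = emeasure \<mu> E)"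
      by (auto intro: measure_eqI)
    then show ?thesis
      by (auto simp: emeasure_distr_density[OF i h0 fst] \<mu>.emeasure_eq_measure nonneg)
  qed
  have snd_iff: "distr (density P h) \<eta> snd = \<eta> \<longleftrightarrow>
      (\<forall>E\<in>sets \<eta>. (\<integral>z. h z * indicator E (snd z) \<partial>P) = measure \<eta> E)" if i: "integrable P h"
  proof -
    have "distr (density P h) \<eta> snd = \<eta> \<longleftrightarrow> (\<forall>E\<in>sets \<eta>. emeasure (distr (density P h) \<eta> snd) E = emeasure \<eta> E)"
      by (auto intro: measure_eqI)
    then show ?thesis
      by (auto simp: emeasure_distr_density[OF i h0 snd] \<eta>.emeasure_eq_measure nonneg)
  qed
  show ?thesis
  proof (cases "integrable P h")
    case True
    have "?L \<longleftrightarrow> prob_space (density P h) \<and>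
        distr (density P h) \<mu> fst = \<mu> \<and> distr (density P h) \<eta> snd = \<eta>"
      by (simp add: couplings_def P)
    with True prob[OF True] fst_iff[OF True] snd_iff[OF True] show ?thesis
      by blast
  qed (use int in blast)
qed

lemma integrable_mult_indicator_comp:
  fixes h :: "'a \<Rightarrow> real"
  assumes "integrable P h" "T \<in> P \<rightarrow>\<^sub>M N" "E \<in> sets N"
  shows "integrable P (\<lambda>x. h x * indicator E (T x))"
proof (rule Bochner_Integration.integrable_bound[OF assms(1)])
  show "(\<lambda>x. h x * indicator E (T x)) \<in> borel_measurable P"
    using assms by measurable
qed (auto simp: indicator_def)

text \<open>Multiplying by an indicator does not increase the L1 distance.\<close>

lemma tendsto_integral_mult_indicator:
  fixes F :: "nat \<Rightarrow> 'a \<Rightarrow> real"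
  assumes F: "\<And>n. integrable P (F n)" and f: "integrable P f"
    and T[measurable]: "T \<in> P \<rightarrow>\<^sub>M N" and E[measurable]: "E \<in> sets N"
    and lim: "(\<lambda>n. \<integral>\<^sup>+x. ennreal \<bar>F n x - f x\<bar> \<partial>P) \<longlonglongrightarrow> 0"
  shows "(\<lambda>n. \<integral>x. F n x * indicator E (T x) \<partial>P) \<longlonglongrightarrow> (\<integral>x. f x * indicator E (T x) \<partial>P)"
proof (rule tendsto_L1_int)
  show "(\<lambda>n. \<integral>\<^sup>+x. ennreal (norm (F n x * indicator E (T x) - f x * indicator E (T x))) \<partial>P) \<longlonglongrightarrow> 0"
    by (rule tendsto_sandwich[OF _ _ tendsto_const lim])
      (auto intro!: always_eventually nn_integral_mono ennreal_leI simp: indicator_def)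
qed (use F f in \<open>auto intro!: integrable_mult_indicator_comp[OF _ T E]\<close>)

text \<open>\<open>arg_min_on\<close> is a Hilbert choice and says nothing unless a minimizer
  exists. The couplings meet the conditions of the existence result, since their marginal
  constraints are linear in the density and continuous in L1. Finiteness follows by comparison with
  the given coupling of finite entropy.\<close>

lemma schrodinger_bridge_coupling:
  assumes "prob_space \<mu>" "prob_space \<eta>" and K: "K \<in> \<mu> \<rightarrow>\<^sub>M prob_algebra \<eta>"
    and ex: "\<exists>Q\<in>couplings \<mu> \<eta>. relative_entropy Q (joint \<mu> \<eta> K) < \<infinity>"
  shows "schrodinger_bridge \<mu> \<eta> K \<in> couplings \<mu> \<eta>"
    and "relative_entropy (schrodinger_bridge \<mu> \<eta> K) (joint \<mu> \<eta> K) < \<infinity>"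
proof -
  let ?P = "joint \<mu> \<eta> K" and ?C = "couplings \<mu> \<eta>"
  let ?H = "\<lambda>Q. relative_entropy Q ?P"
  have P: "prob_space ?P" "sets ?P = sets (\<mu> \<Otimes>\<^sub>M \<eta>)"
    using prob_space_joint sets_joint assms by blast+
  have fst: "fst \<in> ?P \<rightarrow>\<^sub>M \<mu>" and snd: "snd \<in> ?P \<rightarrow>\<^sub>M \<eta>"
    by (simp_all add: P cong: measurable_cong_sets)
  note iff = density_in_couplings_iff[OF assms(1,2) P(2)]
  have "\<exists>Q\<in>?C. \<forall>R\<in>?C. ?H Q \<le> ?H R"
  proof (rule relative_entropy_minimizer_exists[OF P(1)])
    fix f g :: "'a \<times> 'b \<Rightarrow> real"
    assume m[measurable]: "f \<in> borel_measurable ?P" "g \<in> borel_measurable ?P"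
      and nonneg: "\<And>z. 0 \<le> f z" "\<And>z. 0 \<le> g z"
      and C: "density ?P f \<in> ?C" "density ?P g \<in> ?C"
    note f = iff[OF m(1) nonneg(1), THEN iffD1, OF C(1)]
    note g = iff[OF m(2) nonneg(2), THEN iffD1, OF C(2)]
    have "(\<integral>z. (f z + g z) / 2 * indicator E (T z) \<partial>?P) =
        ((\<integral>z. f z * indicator E (T z) \<partial>?P) + (\<integral>z. g z * indicator E (T z) \<partial>?P)) / 2"
      if "T \<in> ?P \<rightarrow>\<^sub>M N" "E \<in> sets N" for T and E :: "'c set" and N
    proof -
      have "(\<integral>z. (f z + g z) / 2 * indicator E (T z) \<partial>?P) =
          (\<integral>z. (f z * indicator E (T z) + g z * indicator E (T z)) / 2 \<partial>?P)"
        by (intro Bochner_Integration.integral_cong) (auto simp: field_simps)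
      then show ?thesis
        using f g by (simp add: integrable_mult_indicator_comp[OF _ that])
    qed
    from this[OF fst] this[OF snd] show "density ?P (\<lambda>z. (f z + g z) / 2) \<in> ?C"
      using f g nonneg by (subst iff) auto
  next
    fix F :: "nat \<Rightarrow> 'a \<times> 'b \<Rightarrow> real" and f
    assume Fm[measurable]: "\<And>n. F n \<in> borel_measurable ?P" and fm[measurable]: "f \<in> borel_measurable ?P"
      and nonneg: "\<And>n z. 0 \<le> F n z" "\<And>z. 0 \<le> f z" and C: "\<And>n. density ?P (F n) \<in> ?C"
      and lim: "(\<lambda>n. \<integral>\<^sup>+z. ennreal \<bar>F n z - f z\<bar> \<partial>?P) \<longlonglongrightarrow> 0"
    note F = iff[OF Fm nonneg(1), THEN iffD1, OF C]
    \<comment> \<open>One term within L1 distance 1 suffices: \<open>f\<close> is then the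
      integrable function \<open>F n\<close> minus an integrable difference.\<close>
    have "\<forall>\<^sub>F n in sequentially. (\<integral>\<^sup>+z. ennreal \<bar>F n z - f z\<bar> \<partial>?P) < 1"
      using lim by (rule order_tendstoD) simp
    then obtain n where "(\<integral>\<^sup>+z. ennreal \<bar>F n z - f z\<bar> \<partial>?P) < 1"
      by (auto simp: eventually_sequentially)
    then have "integrable ?P (\<lambda>z. F n z - f z)"
      by (intro integrableI_bounded) (auto intro: less_trans)
    then have f: "integrable ?P f"
      using Bochner_Integration.integrable_diff[of ?P "F n" "\<lambda>z. F n z - f z"] F by simp
    have "(\<integral>z. f z * indicator E (fst z) \<partial>?P) = measure \<mu> E" if "E \<in> sets \<mu>" for E
      using tendsto_integral_mult_indicator[OF _ f fst that lim] F that
      by (simp add: LIMSEQ_const_iff)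
    moreover have "(\<integral>z. f z * indicator E (snd z) \<partial>?P) = measure \<eta> E" if "E \<in> sets \<eta>" for E
      using tendsto_integral_mult_indicator[OF _ f snd that lim] F that
      by (simp add: LIMSEQ_const_iff)
    ultimately show "density ?P f \<in> ?C"
      using f nonneg by (subst iff) auto
  qed (use ex P in \<open>auto simp: couplings_def\<close>)
  \<comment> \<open>\<open>is_arg_min\<close> asks that no competitor be strictly smaller, which in
    the linear order of the extended reals is minimality.\<close>
  then have "\<exists>Q. is_arg_min ?H (\<lambda>Q. Q \<in> ?C) Q"
    by (auto simp: is_arg_min_def not_less)
  then have "is_arg_min ?H (\<lambda>Q. Q \<in> ?C) (schrodinger_bridge \<mu> \<eta> K)"
    unfolding schrodinger_bridge_def arg_min_on_def arg_min_def by (rule someI_ex)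
  with ex show "schrodinger_bridge \<mu> \<eta> K \<in> ?C" "?H (schrodinger_bridge \<mu> \<eta> K) < \<infinity>"
    unfolding is_arg_min_def by (blast, meson le_less_trans not_less)
qed

section \<open>Telescoping series and the equivalence\<close>

text \<open>The m terms from n on add up to h n - h (n + m), so their limit is h n exactly when h
  tends to 0. The sums live in the extended reals, where nonnegativity of \<open>d\<close>
  guarantees that they exist.\<close>

lemma tendsto_0_iff_suminf_telescope:
  fixes h d :: "nat \<Rightarrow> real"
  assumes h: "\<And>n. h n = d n + h (Suc n)" and d: "\<And>n. 0 \<le> d n"
  shows "h \<longlonglongrightarrow> 0 \<longleftrightarrow> (\<forall>n. ereal (h n) = (\<Sum>l. ereal (d (n + l))))"
proof -
  have sum: "(\<Sum>l<m. d (n + l)) = h n - h (n + m)" for n m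
  proof (induction m)
    case (Suc m)
    then show ?case using h[of "n + m"] by simp
  qed simp
  show ?thesis
  proof
    assume lim: "h \<longlonglongrightarrow> 0"
    have "(\<lambda>l. d (n + l)) sums h n" for n
    proof -
      have "(\<lambda>m. h n - h (n + m)) \<longlonglongrightarrow> h n - 0"
        using LIMSEQ_ignore_initial_segment[OF lim, of n]
        by (intro tendsto_diff tendsto_const) (simp add: add.commute)
      then show ?thesis
        by (simp add: sums_def sum)
    qed
    then have "(\<lambda>l. ereal (d (n + l))) sums ereal (h n)" for n
      by (simp add: sums_ereal)
    then show "\<forall>n. ereal (h n) = (\<Sum>l. ereal (d (n + l)))"
      by (blast intro: sums_unique)
  next
    assume "\<forall>n. ereal (h n) = (\<Sum>l. ereal (d (n + l)))"
    \<comment> \<open>The identity at 0 already determines the limit: h 0 - h m tends to h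
      0.\<close>
    from this[rule_format, of 0] have "(\<lambda>l. ereal (d l)) sums ereal (h 0)"
      using summable_sums[OF summable_ereal_pos, of "\<lambda>l. ereal (d l)"] d by simp
    then have "(\<lambda>m. h 0 - h m) \<longlonglongrightarrow> h 0"
      using sum[of 0] by (simp add: sums_ereal sums_def)
    then have "(\<lambda>m. h 0 - (h 0 - h m)) \<longlonglongrightarrow> h 0 - h 0"
      by (intro tendsto_diff tendsto_const)
    then show "h \<longlonglongrightarrow> 0" by simp
  qed
qed

theorem proposition4p6:
  fixes \<mu> :: "'a measure" and \<eta> :: "'b measure"
    and K :: "'a \<Rightarrow> 'b measure"
    and A :: "nat \<Rightarrow> 'a \<Rightarrow> 'b measure" and B :: "nat \<Rightarrow> 'b \<Rightarrow> 'a measure"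
  assumes "prob_space \<mu>" and "prob_space \<eta>"
    and "K \<in> \<mu> \<rightarrow>\<^sub>M prob_algebra \<eta>"
    and "\<exists>Q\<in>couplings \<mu> \<eta>. relative_entropy Q (joint \<mu> \<eta> K) < \<infinity>"
    and "sinkhorn_transitions \<mu> \<eta> K A B"
    and "(\<Sum>l. relative_entropy \<eta> (\<mu> \<bind> A l)) < \<infinity> \<or>
         (\<Sum>l. relative_entropy \<mu> (\<eta> \<bind> B l)) < \<infinity>"
  shows "((\<lambda>n. relative_entropy (schrodinger_bridge \<mu> \<eta> K) (joint \<mu> \<eta> (A n)))
             \<longlonglongrightarrow> 0)
     \<longleftrightarrow>
     (\<forall>n. relative_entropy (schrodinger_bridge \<mu> \<eta> K) (joint \<mu> \<eta> (A n)) =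
          (\<Sum>l. relative_entropy \<eta> (\<mu> \<bind> A (n + l)) + relative_entropy \<mu> (\<eta> \<bind> B (n + l))))"
proof -
  define Q where "Q = schrodinger_bridge \<mu> \<eta> K"
  have Q: "Q \<in> couplings \<mu> \<eta>" and Q_fin: "relative_entropy Q (joint \<mu> \<eta> K) < \<infinity>"
    unfolding Q_def by (rule schrodinger_bridge_coupling[OF assms(1-4)])+
  have A0: "A 0 = K" and A: "\<And>n. A n \<in> \<mu> \<rightarrow>\<^sub>M prob_algebra \<eta>" and B: "\<And>n. B n \<in> \<eta> \<rightarrow>\<^sub>M prob_algebra \<mu>"
    and AB: "\<And>n. joint \<mu> \<eta> (A n) = joint_rev \<mu> (\<mu> \<bind> A n) (B n)"
    and BA: "\<And>n. joint_rev \<mu> \<eta> (B n) = joint (\<eta> \<bind> B n) \<eta> (A (Suc n))"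
    using assms(5) unfolding sinkhorn_transitions_def by blast+
  define H a b where "H n = relative_entropy Q (joint \<mu> \<eta> (A n))"
    and "a n = relative_entropy \<eta> (\<mu> \<bind> A n)" and "b n = relative_entropy \<mu> (\<eta> \<bind> B n)" for n
  note stepA = relative_entropy_joint_Bayes[OF assms(1,2) A B AB Q]
  note stepB = relative_entropy_joint_rev_Bayes[OF assms(1,2) A B BA Q]
  \<comment> \<open>Each half-step passes finiteness on, first to the bridge of odd index and then
    to the next even one, starting from the finite entropy relative to the reference
    measure.\<close>
  have H_fin: "H n < \<infinity>" for n
  proof (induction n)
    case 0
    show ?case using Q_fin by (simp add: H_def A0)
  next
    case (Suc n)
    then show ?case
      unfolding H_def using stepB(3) stepA(3) by blast
  qed
  \<comment> \<open>Two half-steps combined: a full iteration lowers the entropy by the sum of the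
    two marginal entropies.\<close>
  have H_step: "H n = a n + b n + H (Suc n)" and a_fin: "a n < \<infinity>" and b_fin: "b n < \<infinity>" for n
    using H_fin[of n] stepA[of n] stepB[of n] unfolding H_def a_def b_def
    by (simp_all add: add.assoc)
  have prob_joint: "prob_space (joint \<mu> \<eta> (A n))" "sets (joint \<mu> \<eta> (A n)) = sets (\<mu> \<Otimes>\<^sub>M \<eta>)" for n
    using prob_space_joint[OF assms(1) A] sets_joint[OF assms(1) A] by auto
  have space: "\<mu> \<in> space (prob_algebra \<mu>)" "\<eta> \<in> space (prob_algebra \<eta>)"
    using assms by (auto simp: space_prob_algebra)
  have H_nonneg: "0 \<le> H n" for n
    unfolding H_def using Q prob_joint by (intro relative_entropy_nonneg) (auto simp: couplings_def)
  have a_nonneg: "0 \<le> a n" for n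
    unfolding a_def using prob_space_bind'[OF space(1) A] sets_bind'[OF space(1) A] assms(2)
    by (intro relative_entropy_nonneg) auto
  have b_nonneg: "0 \<le> b n" for n
    unfolding b_def using prob_space_bind'[OF space(2) B] sets_bind'[OF space(2) B] assms(1)
    by (intro relative_entropy_nonneg) auto
  \<comment> \<open>All quantities are finite and nonnegative, so \<open>real_of_ereal\<close> loses
    nothing and the telescoping subtraction takes place in the reals.\<close>
  define h d where "h n = real_of_ereal (H n)" and "d n = real_of_ereal (a n + b n)" for n
  have h: "H n = ereal (h n)" for n
    using H_nonneg[of n] H_fin[of n] by (cases "H n") (auto simp: h_def)
  have d: "a n + b n = ereal (d n)" for n
    using a_nonneg[of n] a_fin[of n] b_nonneg[of n] b_fin[of n]
    by (cases "a n"; cases "b n") (auto simp: d_def)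
  have "h n = d n + h (Suc n)" for n
    using H_step[of n] by (simp add: h d)
  moreover have "0 \<le> d n" for n
    using a_nonneg[of n] b_nonneg[of n] by (simp add: d_def real_of_ereal_pos)
  ultimately have "h \<longlonglongrightarrow> 0 \<longleftrightarrow> (\<forall>n. ereal (h n) = (\<Sum>l. ereal (d (n + l))))"
    by (rule tendsto_0_iff_suminf_telescope)
  moreover have "H \<longlonglongrightarrow> 0 \<longleftrightarrow> h \<longlonglongrightarrow> 0"
    unfolding h[abs_def] zero_ereal_def by simp
  ultimately have "H \<longlonglongrightarrow> 0 \<longleftrightarrow> (\<forall>n. H n = (\<Sum>l. a (n + l) + b (n + l)))"
    by (simp add: h d)
  then show ?thesis
    unfolding H_def a_def b_def Q_def .
qed

end
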